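(* For every $(K,\Sigma)\in\Omega$, with the Gaussian linear policy $\pi(u|x)=\mathcal N(-Kx,\Sigma)$ and $x_t$ following the dynamics $x_{t+1}=(A+w_t^xC)x_t+(B+w_t^uD)u_t$, one has $$f(K,\Sigma)=\mathbb{E}_{x_0\sim\mathcal D}[C_{K,\Sigma}(x_0)]=P_K\mu+q_{K,\Sigma},$$ where $\mu=\mathbb{E}_{x_0\sim\mathcal D}[x_0^2]$, the scalar $P_K$ satisfies $$P_K=Q+K^\top RK+\gamma P_K\big(A^2+C^2+K^\top(B^\top B+D^\top D)K-2ABK\big),$$ and $$q_{K,\Sigma}=\frac{\mathrm{Tr}\big(\Sigma(R+\gamma P_K(B^\top B+D^\top D))\big)-\frac{\tau}{2}\big(n+\log((2\pi)^n\det\Sigma)\big)}{1-\gamma}.$$ Consequently, the entropy-regularized control problem over such policies is the optimization problem $\min_{(K,\Sigma)\in\Omega}f(K,\Sigma)$.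
   Context: Let $n\ge1$, $A,C\in\mathbb{R}$, $B\in\mathbb{R}^{1\times n}$ (row vector), $D\in\mathbb{R}^{n\times n}$, $Q\in\mathbb{R}$, $R\in\mathbb{R}^{n\times n}$ symmetric, $\gamma\in(0,1)$, $\tau>0$. State $x_t\in\mathbb{R}$, control $u_t\in\mathbb{R}^n$, dynamics $x_{t+1}=(A+w_t^xC)x_t+(B+w_t^uD)u_t$ with white noises $w_t^x\in\mathbb{R}$, $w_t^u\in\mathbb{R}^{1\times n}$, independent across time, of each other and of the control randomization, $\mathbb{E}w_t^x=0$, $\mathbb{E}(w_t^x)^2=1$, $\mathbb{E}w_t^u=0$, $\mathbb{E}[(w_t^u)^\top w_t^u]=I_n$. For $K\in\mathbb{R}^n$ (column vector) and symmetric positive definite $\Sigma$, the policy $\pi_{K,\Sigma}$ draws $u_t\sim\mathcal N(-Kx_t,\Sigma)$. Let $V_K=A^2+C^2+K^\top(B^\top B+D^\top D)K-2ABK$ and $\Omega=\{(K,\Sigma):K\in\mathbb{R}^n,\ \Sigma\in\mathbb{R}^{n\times n},\ \Sigma=\Sigma^\top\succ0,\ \gamma V_K<1\}$. For a deterministic initial state $x_0$, $C_{K,\Sigma}(x_0)=\mathbb{E}\big[\sum_{t=0}^\infty\gamma^t(Qx_t^2+u_t^\top Ru_t+\tau\log\pi_{K,\Sigma}(u_t|x_t))\big]$ with $u_t\sim\mathcal N(-Kx_t,\Sigma)$, where $\pi_{K,\Sigma}(\cdot|x)$ is the Gaussian density; $\mathcal D$ is the initial state distribution. *)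

theory Defs
  imports "HOL-Probability.Probability"
begin

text \<open>Density of the multivariate Gaussian N(m, S) on real^'n (S symmetric positive definite).\<close>
definition gauss_pdf :: "real^'n^'n \<Rightarrow> real^'n \<Rightarrow> real^'n \<Rightarrow> real" where
  "gauss_pdf S m u =
     exp (- (1/2) * ((u - m) \<bullet> (matrix_inv S *v (u - m))))
       / sqrt ((2 * pi) ^ CARD('n) * det S)"

definition sym_posdef :: "real^'n^'n \<Rightarrow> bool" where
  "sym_posdef S \<longleftrightarrow> transpose S = S \<and> (\<forall>v. v \<noteq> 0 \<longrightarrow> v \<bullet> (S *v v) > 0)"

text \<open>Outer product B^T B of a row vector B.\<close>
definition outer :: "real^'n \<Rightarrow> real^'n \<Rightarrow> real^'n^'n" where
  "outer a b = (\<chi> i j. a $ i * b $ j)"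

text \<open>V_K = A^2 + C^2 + K^T (B^T B + D^T D) K - 2 A B K\<close>
definition V_K :: "real \<Rightarrow> real \<Rightarrow> real^'n \<Rightarrow> real^'n^'n \<Rightarrow> real^'n \<Rightarrow> real" where
  "V_K A C B D K = A^2 + C^2 + K \<bullet> ((outer B B + transpose D ** D) *v K) - 2 * A * (B \<bullet> K)"

text \<open>Omega: admissible policy parameters.\<close>
definition Omega :: "real \<Rightarrow> real \<Rightarrow> real \<Rightarrow> real^'n \<Rightarrow> real^'n^'n \<Rightarrow> ((real^'n) \<times> (real^'n^'n)) set" where
  "Omega \<gamma> A C B D = {(K, S). sym_posdef S \<and> \<gamma> * V_K A C B D K < 1}"

text \<open>Control u_t = -K x_t + xi_t, where xi_t ~ N(0, Sigma) is the policy randomization,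
  so that u_t ~ N(-K x_t, Sigma) given x_t.\<close>
primrec ctrl_state ::
  "real \<Rightarrow> real \<Rightarrow> real^'n \<Rightarrow> real^'n^'n \<Rightarrow> real^'n \<Rightarrow>
   (nat \<Rightarrow> 'a \<Rightarrow> real) \<Rightarrow> (nat \<Rightarrow> 'a \<Rightarrow> real^'n) \<Rightarrow> (nat \<Rightarrow> 'a \<Rightarrow> real^'n) \<Rightarrow>
   real \<Rightarrow> nat \<Rightarrow> 'a \<Rightarrow> real" where
  "ctrl_state A C B D K wx wu xi x0 0 \<omega> = x0"
| "ctrl_state A C B D K wx wu xi x0 (Suc t) \<omega> =
     (let x = ctrl_state A C B D K wx wu xi x0 t \<omega>;
          u = xi t \<omega> - x *\<^sub>R K
      in (A + wx t \<omega> * C) * x + (B + wu t \<omega> v* D) \<bullet> u)"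

definition ctrl_input ::
  "real \<Rightarrow> real \<Rightarrow> real^'n \<Rightarrow> real^'n^'n \<Rightarrow> real^'n \<Rightarrow>
   (nat \<Rightarrow> 'a \<Rightarrow> real) \<Rightarrow> (nat \<Rightarrow> 'a \<Rightarrow> real^'n) \<Rightarrow> (nat \<Rightarrow> 'a \<Rightarrow> real^'n) \<Rightarrow>
   real \<Rightarrow> nat \<Rightarrow> 'a \<Rightarrow> real^'n" where
  "ctrl_input A C B D K wx wu xi x0 t \<omega> =
     xi t \<omega> - ctrl_state A C B D K wx wu xi x0 t \<omega> *\<^sub>R K"

text \<open>C_{K,Sigma}(x0): expected discounted entropy-regularized cost from deterministic x0.\<close>
definition ctrl_cost ::
  "'a measure \<Rightarrow> real \<Rightarrow> real \<Rightarrow> real^'n \<Rightarrow> real^'n^'n \<Rightarrow> real \<Rightarrow> real^'n^'n \<Rightarrow> real \<Rightarrow> real \<Rightarrow>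
   real^'n \<Rightarrow> real^'n^'n \<Rightarrow>
   (nat \<Rightarrow> 'a \<Rightarrow> real) \<Rightarrow> (nat \<Rightarrow> 'a \<Rightarrow> real^'n) \<Rightarrow> (nat \<Rightarrow> 'a \<Rightarrow> real^'n) \<Rightarrow> real \<Rightarrow> real" where
  "ctrl_cost M A C B D Q R \<gamma> \<tau> K S wx wu xi x0 =
     integral\<^sup>L M (\<lambda>\<omega>. \<Sum>t. \<gamma> ^ t *
        (let x = ctrl_state A C B D K wx wu xi x0 t \<omega>;
             u = ctrl_input A C B D K wx wu xi x0 t \<omega>
         in Q * x^2 + u \<bullet> (R *v u) + \<tau> * ln (gauss_pdf S (- (x *\<^sub>R K)) u)))"

text \<open>Generated sigma-algebras of all noise variables, indexed by (time, component):
  component 0 = w^x_t, 1 = w^u_t, 2 = policy randomization xi_t.  Mutual independence of the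
  whole family is expressed by indep_sets over UNIV x {0,1,2}.\<close>
definition noise_events ::
  "'a measure \<Rightarrow> (nat \<Rightarrow> 'a \<Rightarrow> real) \<Rightarrow> (nat \<Rightarrow> 'a \<Rightarrow> real^'n) \<Rightarrow> (nat \<Rightarrow> 'a \<Rightarrow> real^'n) \<Rightarrow>
   nat \<times> nat \<Rightarrow> 'a set set" where
  "noise_events M wx wu xi = (\<lambda>(t, k).
     if k = 0 then {wx t -` A \<inter> space M | A. A \<in> sets (borel :: real measure)}
     else if k = 1 then {wu t -` A \<inter> space M | A. A \<in> sets (borel :: (real^'n) measure)}
     else {xi t -` A \<inter> space M | A. A \<in> sets (borel :: (real^'n) measure)})"

end

theory Submission
  imports Defs
begin

(*
  Write u_t = xi_t - x_t K with xi_t ~ N(0, Sigma). The state then obeys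
  x_(t+1) = g_t x_t + b_t . xi_t, where b_t = B + w^u_t D and g_t = A + w^x_t C - b_t . K
  only involve the noise at time t, which is independent of x_t. Hence E g_t^2 = V_K and
  E x_(t+1)^2 = V_K E x_t^2 + Tr(Sigma (B^T B + D^T D)). The logarithm of the Gaussian density is
  a quadratic form in xi_t, so the expected stage cost is
  (Q + K^T R K) E x_t^2 + Tr(Sigma R) - tau/2 (n + log((2 pi)^n det Sigma)).
  Since gamma V_K < 1 all discounted series converge absolutely; exchanging expectation and sum
  and summing the affine recursion for E x_t^2 against gamma^t gives P_K x_0^2 + q_(K,Sigma).
  The Gaussian moments of xi_t come from its moment generating function exp(a . Sigma a / 2),
  which is computed by translating Lebesgue measure.
*)

section \<open>Moments from the moment generating function\<close>

lemma abs_sinh_le_abs_mult_cosh: "\<bar>sinh x\<bar> \<le> \<bar>x\<bar> * cosh (x::real)"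
proof -
  have "sinh y \<le> y * cosh y" if "0 < y" for y :: real
  proof -
    have "\<And>x. DERIV sinh x :> cosh x" by (auto intro!: derivative_eq_intros)
    then obtain e where e: "0 < e" "e < y" "sinh y - sinh 0 = (y - 0) * cosh e"
      using MVT2[OF \<open>0 < y\<close>, of sinh cosh] by blast
    have "cosh e \<le> cosh y" using e by (subst cosh_real_nonneg_le_iff) auto
    with e \<open>0 < y\<close> show ?thesis by (simp add: mult_left_mono)
  qed
  from this[of "\<bar>x\<bar>"] show ?thesis by (cases "x = 0") auto
qed

lemma cosh_minus_one_le: "cosh x - 1 \<le> x\<^sup>2 * cosh (x::real)"
proof -
  have "cosh y - 1 \<le> y\<^sup>2 * cosh y" if "0 < y" for y :: real
  proof -
    have "\<And>x. DERIV cosh x :> sinh x" by (auto intro!: derivative_eq_intros)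
    then obtain e where e: "0 < e" "e < y" "cosh y - cosh 0 = (y - 0) * sinh e"
      using MVT2[OF \<open>0 < y\<close>, of cosh sinh] by blast
    have "sinh e \<le> e * cosh e" using abs_sinh_le_abs_mult_cosh[of e] e by simp
    also have "\<dots> \<le> y * cosh y"
      using e by (intro mult_mono) (auto simp: cosh_real_nonneg_le_iff)
    finally show ?thesis using e \<open>0 < y\<close> by (simp add: power2_eq_square mult_left_mono)
  qed
  from this[of "\<bar>x\<bar>"] show ?thesis by (cases "x = 0") auto
qed

lemma cosh_le_exp_abs: "cosh x \<le> exp \<bar>x::real\<bar>"
  unfolding cosh_def by (cases "x \<ge> 0") auto

lemma exp_abs_le_two_cosh: "exp \<bar>x\<bar> \<le> 2 * cosh (x::real)"
  unfolding cosh_def by (cases "x \<ge> 0") auto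

lemma cosh_mult_le_exp_abs:
  fixes t y :: real
  assumes "\<bar>t\<bar> \<le> 1"
  shows "cosh (t * y) \<le> exp \<bar>y\<bar>"
proof -
  have "cosh (t * y) = cosh \<bar>t * y\<bar>" by simp
  also have "\<dots> \<le> cosh \<bar>y\<bar>"
    using assms by (subst cosh_real_nonneg_le_iff) (auto simp: abs_mult mult_left_le_one_le)
  also have "\<dots> \<le> exp \<bar>y\<bar>" by (simp add: cosh_le_exp_abs)
  finally show ?thesis .
qed

lemma abs_sinh_quotient_le:
  fixes t y :: real
  assumes "0 < t" "t \<le> 1"
  shows "\<bar>sinh (t * y) / t\<bar> \<le> 2 * cosh (2 * y)"
proof -
  have "\<bar>sinh (t * y)\<bar> \<le> t * \<bar>y\<bar> * cosh (t * y)"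
    using abs_sinh_le_abs_mult_cosh[of "t * y"] assms by (simp add: abs_mult)
  also have "\<dots> \<le> t * \<bar>y\<bar> * exp \<bar>y\<bar>"
    using assms cosh_mult_le_exp_abs[of t y] by (intro mult_left_mono) auto
  finally have "\<bar>sinh (t * y) / t\<bar> \<le> \<bar>y\<bar> * exp \<bar>y\<bar>"
    using assms by (simp add: divide_le_eq mult_ac)
  also have "\<dots> \<le> exp \<bar>y\<bar> * exp \<bar>y\<bar>"
    using exp_ge_add_one_self[of "\<bar>y\<bar>"] by (intro mult_right_mono) (linarith, simp)
  also have "\<dots> = exp \<bar>2 * y\<bar>" by (simp flip: exp_add)
  also have "\<dots> \<le> 2 * cosh (2 * y)" by (rule exp_abs_le_two_cosh)
  finally show ?thesis .
qed

lemma abs_cosh_quotient_le: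
  fixes t y :: real
  assumes "0 < t" "t \<le> 1"
  shows "\<bar>2 * (cosh (t * y) - 1) / t\<^sup>2\<bar> \<le> 8 * cosh (2 * y)"
proof -
  have "0 \<le> cosh (t * y) - 1" using cosh_real_ge_1 by simp
  then have "\<bar>2 * (cosh (t * y) - 1) / t\<^sup>2\<bar> = 2 * (cosh (t * y) - 1) / t\<^sup>2" by simp
  also have "\<dots> \<le> 2 * ((t * y)\<^sup>2 * cosh (t * y)) / t\<^sup>2"
    using cosh_minus_one_le[of "t * y"] by (intro divide_right_mono) auto
  also have "\<dots> = 2 * (y\<^sup>2 * cosh (t * y))" using assms by (simp add: power_mult_distrib)
  also have "\<dots> \<le> 2 * ((2 * exp \<bar>y\<bar>) * exp \<bar>y\<bar>)"
  proof -
    have "y\<^sup>2 \<le> 2 * exp \<bar>y\<bar>"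
      using exp_lower_Taylor_quadratic[of "\<bar>y\<bar>"] by simp
    then show ?thesis
      using assms cosh_mult_le_exp_abs[of t y] by (intro mult_left_mono mult_mono) auto
  qed
  also have "\<dots> = 4 * exp \<bar>2 * y\<bar>" by (simp flip: exp_add)
  also have "\<dots> \<le> 8 * cosh (2 * y)" using exp_abs_le_two_cosh[of "2 * y"] by simp
  finally show ?thesis .
qed

lemma tendsto_sinh_quotient_0: "((\<lambda>h. sinh (h * a) / h) \<longlongrightarrow> a) (at (0::real))"
proof -
  have "DERIV (\<lambda>h. sinh (h * a)) 0 :> a" by (auto intro!: derivative_eq_intros)
  then show ?thesis by (simp add: DERIV_def)
qed

lemma tendsto_cosh_quotient_0: "((\<lambda>h. 2 * (cosh (h * a) - 1) / h\<^sup>2) \<longlongrightarrow> a\<^sup>2) (at (0::real))"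
proof -
  have "2 * (cosh (h * a) - 1) / h\<^sup>2 = (2 * (sinh (h * (a / 2)) / h))\<^sup>2" for h
  proof -
    have "cosh (h * a) = cosh (2 * (h * (a / 2)))" by simp
    then show ?thesis by (simp only: cosh_double cosh_square_eq) (simp add: power_divide)
  qed
  moreover have "((\<lambda>h. (2 * (sinh (h * (a / 2)) / h))\<^sup>2) \<longlongrightarrow> (2 * (a / 2))\<^sup>2) (at 0)"
    by (intro tendsto_intros tendsto_sinh_quotient_0)
  ultimately show ?thesis by simp
qed

lemma tendsto_exp_sq_quotient_0: "((\<lambda>h. 2 * (exp (h\<^sup>2 * v / 2) - 1) / h\<^sup>2) \<longlongrightarrow> v) (at (0::real))"
proof -
  have "DERIV (\<lambda>s. exp (s * v / 2)) 0 :> v / 2" by (auto intro!: derivative_eq_intros)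
  then have "((\<lambda>s. (exp (s * v / 2) - 1) / s) \<longlongrightarrow> v / 2) (at 0)" by (simp add: DERIV_def)
  moreover have "filterlim (\<lambda>h::real. h\<^sup>2) (at 0) (at 0)"
    by (rule filterlim_atI) (auto intro!: tendsto_eq_intros simp: eventually_at_filter)
  ultimately have "((\<lambda>h. (exp (h\<^sup>2 * v / 2) - 1) / h\<^sup>2) \<longlongrightarrow> v / 2) (at 0)"
    by (rule filterlim_compose)
  then show ?thesis by (auto dest: tendsto_mult_left[where c = 2])
qed

(* E Y and E Y^2 are the first two derivatives of the moment generating function at 0. They are
   reached through the difference quotients sinh (t Y) / t and 2 (cosh (t Y) - 1) / t^2, which the
   estimates above dominate by 8 cosh (2 Y). *)
lemma (in prob_space) moments_of_gaussian_mgf: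
  fixes Y :: "'a \<Rightarrow> real"
  assumes [measurable]: "Y \<in> borel_measurable M"
    and integrable_exp: "\<And>c. integrable M (\<lambda>\<omega>. exp (c * Y \<omega>))"
    and mgf: "\<And>c. expectation (\<lambda>\<omega>. exp (c * Y \<omega>)) = exp (c\<^sup>2 * v / 2)"
  shows "integrable M Y" "expectation Y = 0"
    "integrable M (\<lambda>\<omega>. (Y \<omega>)\<^sup>2)" "expectation (\<lambda>\<omega>. (Y \<omega>)\<^sup>2) = v"
proof -
  define t where "t k = inverse (real (Suc k))" for k
  have t: "0 < t k" "t k \<le> 1" for k unfolding t_def by (auto simp: field_simps)
  have t_to_0: "filterlim t (at 0) sequentially"
    unfolding t_def filterlim_at using LIMSEQ_inverse_real_of_nat by auto
  define s where "s k \<omega> = sinh (t k * Y \<omega>) / t k" for k \<omega>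
  define q where "q k \<omega> = 2 * (cosh (t k * Y \<omega>) - 1) / (t k)\<^sup>2" for k \<omega>
  define W where "W \<omega> = 8 * cosh (2 * Y \<omega>)" for \<omega>
  have W: "integrable M W"
    unfolding W_def cosh_def using integrable_exp[of 2] integrable_exp[of "-2"] by simp
  have bounds: "AE \<omega> in M. norm (s k \<omega>) \<le> W \<omega>" "AE \<omega> in M. norm (q k \<omega>) \<le> W \<omega>" for k
  proof (rule_tac [!] AE_I2)
    fix \<omega>
    show "norm (s k \<omega>) \<le> W \<omega>"
      using abs_sinh_quotient_le[OF t, of k "Y \<omega>"] cosh_real_pos[of "2 * Y \<omega>"]
      unfolding s_def W_def real_norm_def by linarith
    show "norm (q k \<omega>) \<le> W \<omega>"
      using abs_cosh_quotient_le[OF t, of k "Y \<omega>"] unfolding q_def W_def by simp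
  qed
  have limits: "AE \<omega> in M. (\<lambda>k. s k \<omega>) \<longlonglongrightarrow> Y \<omega>" "AE \<omega> in M. (\<lambda>k. q k \<omega>) \<longlonglongrightarrow> (Y \<omega>)\<^sup>2"
    unfolding s_def q_def
    by (intro AE_I2 filterlim_compose[OF tendsto_sinh_quotient_0 t_to_0]
        filterlim_compose[OF tendsto_cosh_quotient_0 t_to_0])+
  have [measurable]: "s k \<in> borel_measurable M" "q k \<in> borel_measurable M" for k
    unfolding s_def q_def sinh_def cosh_def by measurable
  note s_conv = integrable_dominated_convergence[OF _ _ W limits(1) bounds(1)]
    integral_dominated_convergence[OF _ _ W limits(1) bounds(1)]
  note q_conv = integrable_dominated_convergence[OF _ _ W limits(2) bounds(2)]
    integral_dominated_convergence[OF _ _ W limits(2) bounds(2)]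
  have "expectation (s k) = 0" for k
    unfolding s_def sinh_def using integrable_exp[of "t k"] integrable_exp[of "- t k"] mgf[of "- t k"]
    by (simp add: mgf)
  moreover have "(\<lambda>k. expectation (q k)) \<longlonglongrightarrow> v"
  proof -
    have "expectation (q k) = 2 * (exp ((t k)\<^sup>2 * v / 2) - 1) / (t k)\<^sup>2" for k
      unfolding q_def cosh_def using integrable_exp[of "t k"] integrable_exp[of "- t k"] mgf[of "- t k"]
      by (simp add: mgf prob_space diff_divide_distrib add_divide_distrib)
    then show ?thesis
      using filterlim_compose[OF tendsto_exp_sq_quotient_0 t_to_0] by simp
  qed
  ultimately show "integrable M Y" "expectation Y = 0"
    "integrable M (\<lambda>\<omega>. (Y \<omega>)\<^sup>2)" "expectation (\<lambda>\<omega>. (Y \<omega>)\<^sup>2) = v"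
    using s_conv q_conv by (auto intro: LIMSEQ_unique)
qed

section \<open>Matrices, discounted series and exchange of sum and integral\<close>

lemma trace_transpose_mult: "trace (transpose A ** B) = (\<Sum>i\<in>UNIV. \<Sum>j\<in>UNIV. A $ i $ j * B $ i $ j)"
  unfolding trace_def matrix_matrix_mult_def transpose_def by simp (rule sum.swap)

lemma trace_mult_scaleR: "trace (A ** (c *\<^sub>R B)) = c * trace (A ** B)"
  by (simp add: trace_def matrix_matrix_mult_def sum_distrib_left mult_ac)

lemma vector_matrix_mult_nth: "(w v* D) $ j = w \<bullet> column j D"
  by (simp add: vector_matrix_mult_def column_def inner_vec_def mult.commute)

lemma transpose_mult_self_nth: "(transpose D ** D) $ j $ k = column j D \<bullet> column k D"
  by (simp add: matrix_matrix_mult_def transpose_def column_def inner_vec_def)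

lemma abs_quadratic_form_le:
  fixes R :: "real^'n^'n"
  shows "\<bar>v \<bullet> (R *v v)\<bar> \<le> onorm ((*v) R) * (norm v)\<^sup>2"
proof -
  have "\<bar>v \<bullet> (R *v v)\<bar> \<le> norm v * norm (R *v v)" by (rule Cauchy_Schwarz_ineq2)
  also have "\<dots> \<le> norm v * (onorm ((*v) R) * norm v)"
    by (intro mult_left_mono onorm) auto
  finally show ?thesis by (simp add: power2_eq_square mult_ac)
qed

lemma power2_norm_diff_le: "(norm (a - b))\<^sup>2 \<le> 2 * (norm a)\<^sup>2 + 2 * (norm (b :: 'a::real_normed_vector))\<^sup>2"
proof -
  have "(norm (a - b))\<^sup>2 \<le> (norm a + norm b)\<^sup>2"
    by (intro power_mono norm_triangle_ineq4) simp
  also have "\<dots> \<le> 2 * (norm a)\<^sup>2 + 2 * (norm b)\<^sup>2"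
    using sum_squares_ge_zero[of "norm a - norm b" 0] by (simp add: power2_eq_square algebra_simps)
  finally show ?thesis .
qed

lemma borel_measurable_vec_nth_comp [measurable (raw)]:
  fixes f :: "'a \<Rightarrow> real^'n"
  assumes "f \<in> borel_measurable N"
  shows "(\<lambda>\<omega>. f \<omega> $ i) \<in> borel_measurable N"
  by (rule borel_measurable_continuous_on[OF _ assms]) (intro continuous_intros)

lemma borel_measurable_matrix_vector_mult [measurable (raw)]:
  fixes D :: "real^'n^'m"
  assumes "f \<in> borel_measurable N"
  shows "(\<lambda>\<omega>. D *v f \<omega>) \<in> borel_measurable N"
  by (rule borel_measurable_continuous_on[OF _ assms]) (intro continuous_intros)

lemma borel_measurable_vector_matrix_mult [measurable (raw)]:
  fixes D :: "real^'m^'n"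
  assumes "f \<in> borel_measurable N"
  shows "(\<lambda>\<omega>. f \<omega> v* D) \<in> borel_measurable N"
  using borel_measurable_matrix_vector_mult[OF assms, of "transpose D"] by simp

lemma summable_discounted_affine_recurrence:
  fixes m :: "nat \<Rightarrow> real"
  assumes rec: "\<And>t. m (Suc t) = a * m t + b"
    and nonneg: "\<And>t. 0 \<le> m t" "0 \<le> a" "0 \<le> b"
    and \<gamma>: "0 \<le> \<gamma>" "\<gamma> < 1" "\<gamma> * a < 1"
  shows "summable (\<lambda>t. \<gamma> ^ t * m t)"
proof -
  define L where "L = (m 0 + \<gamma> * b / (1 - \<gamma>)) / (1 - \<gamma> * a)"
  have "L * (1 - \<gamma> * a) = m 0 + \<gamma> * b / (1 - \<gamma>)"
    unfolding L_def using \<gamma> by simp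
  then have L: "m 0 + \<gamma> * a * L + \<gamma> * b * (1 / (1 - \<gamma>)) = L"
    by (simp add: algebra_simps)
  have "(\<Sum>t<n. \<gamma> ^ t * m t) \<le> L" for n
  proof (induction n)
    case 0
    show ?case using \<gamma> nonneg by (simp add: L_def)
  next
    case (Suc n)
    have geometric: "(\<Sum>i<n. \<gamma> ^ i) \<le> 1 / (1 - \<gamma>)"
      using \<gamma> by (simp add: sum_gp_strict divide_right_mono)
    have "(\<Sum>t<Suc n. \<gamma> ^ t * m t) = m 0 + \<gamma> * a * (\<Sum>t<n. \<gamma> ^ t * m t) + \<gamma> * b * (\<Sum>i<n. \<gamma> ^ i)"
      unfolding sum.lessThan_Suc_shift rec by (simp add: sum_distrib_left sum.distrib algebra_simps)
    also have "\<dots> \<le> m 0 + \<gamma> * a * L + \<gamma> * b * (1 / (1 - \<gamma>))"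
      using Suc geometric \<gamma> nonneg by (intro add_mono mult_left_mono) auto
    finally show ?case unfolding L .
  qed
  then show ?thesis
    using \<gamma> nonneg by (intro summableI_nonneg_bounded) auto
qed

lemma sums_discounted_affine_recurrence:
  fixes m :: "nat \<Rightarrow> real"
  assumes rec: "\<And>t. m (Suc t) = a * m t + b"
    and nonneg: "\<And>t. 0 \<le> m t" "0 \<le> a" "0 \<le> b"
    and \<gamma>: "0 \<le> \<gamma>" "\<gamma> < 1" "\<gamma> * a < 1"
  shows "(\<lambda>t. \<gamma> ^ t * m t) sums ((m 0 + \<gamma> * b / (1 - \<gamma>)) / (1 - \<gamma> * a))"
proof -
  let ?s = "\<Sum>t. \<gamma> ^ t * m t"
  have sums: "(\<lambda>t. \<gamma> ^ t * m t) sums ?s"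
    using summable_discounted_affine_recurrence[where m = m, OF assms] by (rule summable_sums)
  have "(\<lambda>t. (\<gamma> * a) * (\<gamma> ^ t * m t) + (\<gamma> * b) * \<gamma> ^ t) sums ((\<gamma> * a) * ?s + (\<gamma> * b) * (1 / (1 - \<gamma>)))"
    using \<gamma> sums by (intro sums_add sums_mult geometric_sums) auto
  then have "(\<lambda>t. \<gamma> ^ Suc t * m (Suc t)) sums ((\<gamma> * a) * ?s + (\<gamma> * b) * (1 / (1 - \<gamma>)))"
    by (simp add: rec algebra_simps)
  then have "(\<lambda>t. \<gamma> ^ t * m t) sums ((\<gamma> * a) * ?s + (\<gamma> * b) * (1 / (1 - \<gamma>)) + m 0)"
    using sums_Suc_iff[of "\<lambda>t. \<gamma> ^ t * m t"] by simp
  with sums have "?s * (1 - \<gamma> * a) = m 0 + \<gamma> * b / (1 - \<gamma>)"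
    by (auto dest: sums_unique2 simp: algebra_simps)
  with \<gamma> have "?s = (m 0 + \<gamma> * b / (1 - \<gamma>)) / (1 - \<gamma> * a)"
    by (simp add: eq_divide_eq)
  with sums show ?thesis by simp
qed

lemma integral_suminf_abs_summable:
  fixes f :: "nat \<Rightarrow> 'a \<Rightarrow> real"
  assumes int: "\<And>t. integrable M (f t)" and summable: "summable (\<lambda>t. \<integral>x. \<bar>f t x\<bar> \<partial>M)"
  shows "(\<integral>x. (\<Sum>t. f t x) \<partial>M) = (\<Sum>t. \<integral>x. f t x \<partial>M)"
proof (rule integral_suminf[OF int])
  have [measurable]: "f t \<in> borel_measurable M" for t using int by auto
  have "(\<integral>\<^sup>+x. (\<Sum>t. ennreal \<bar>f t x\<bar>) \<partial>M) = (\<Sum>t. \<integral>\<^sup>+x. ennreal \<bar>f t x\<bar> \<partial>M)"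
    by (rule nn_integral_suminf) measurable
  also have "\<dots> = (\<Sum>t. ennreal (\<integral>x. \<bar>f t x\<bar> \<partial>M))"
    by (intro suminf_cong nn_integral_eq_integral) (auto simp: int)
  also have "\<dots> = ennreal (\<Sum>t. \<integral>x. \<bar>f t x\<bar> \<partial>M)"
    by (rule suminf_ennreal2) (auto simp: summable)
  finally have "AE x in M. (\<Sum>t. ennreal \<bar>f t x\<bar>) \<noteq> \<infinity>"
    by (intro nn_integral_PInf_AE) auto
  then show "AE x in M. summable (\<lambda>t. norm (f t x))"
    by eventually_elim (auto intro: summable_suminf_not_top)
  show "summable (\<lambda>t. \<integral>x. norm (f t x) \<partial>M)" using summable by simp
qed

section \<open>Centered Gaussian vectors\<close>

lemma sym_posdef_matrix_inv:
  fixes S :: "real^'n^'n"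
  assumes "sym_posdef S"
  shows "S ** matrix_inv S = mat 1" "matrix_inv S ** S = mat 1"
    "transpose (matrix_inv S) = matrix_inv S"
proof -
  have S_sym: "transpose S = S" and pos: "\<And>v. v \<noteq> 0 \<Longrightarrow> v \<bullet> (S *v v) > 0"
    using assms unfolding sym_posdef_def by auto
  have "\<forall>x. S *v x = 0 \<longrightarrow> x = 0"
  proof (intro allI impI)
    fix x assume "S *v x = 0"
    then show "x = 0" using pos[of x] by (cases "x = 0") auto
  qed
  then have "invertible S"
    using matrix_left_invertible_ker invertible_left_inverse by blast
  then have "\<exists>S'. S ** S' = mat 1 \<and> S' ** S = mat 1" unfolding invertible_def .
  then have "S ** matrix_inv S = mat 1 \<and> matrix_inv S ** S = mat 1"
    unfolding matrix_inv_def by (rule someI_ex)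
  then show right: "S ** matrix_inv S = mat 1" and "matrix_inv S ** S = mat 1" by auto
  have "transpose (matrix_inv S) ** S = transpose (transpose S ** matrix_inv S)"
    by (simp add: matrix_transpose_mul)
  then have "transpose (matrix_inv S) ** S = mat 1"
    using right S_sym by (simp add: transpose_mat)
  then have "transpose (matrix_inv S) = transpose (matrix_inv S) ** (S ** matrix_inv S)"
    using right by (simp add: matrix_mul_rid)
  also have "\<dots> = matrix_inv S"
    using \<open>transpose (matrix_inv S) ** S = mat 1\<close> by (simp add: matrix_mul_assoc matrix_mul_lid)
  finally show "transpose (matrix_inv S) = matrix_inv S" .
qed

lemma inner_matrix_vector_mult_sym:
  fixes G :: "real^'n^'n"
  assumes "transpose G = G"
  shows "u \<bullet> (G *v v) = v \<bullet> (G *v u)"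
proof -
  have "u \<bullet> (G *v v) = (u v* G) \<bullet> v" by (simp add: dot_lmul_matrix)
  also have "u v* G = G *v u" using vector_transpose_matrix[of u G] assms by simp
  finally show ?thesis by (simp add: inner_commute)
qed

lemma gauss_pdf_shift:
  fixes S :: "real^'n^'n"
  assumes "sym_posdef S"
  shows "gauss_pdf S 0 (u - S *v a) = gauss_pdf S 0 u * exp (a \<bullet> u - a \<bullet> (S *v a) / 2)"
proof -
  let ?G = "matrix_inv S"
  have GS: "?G *v (S *v a) = a"
    using sym_posdef_matrix_inv(2)[OF assms] by (simp add: matrix_vector_mul_assoc)
  have cross: "(S *v a) \<bullet> (?G *v u) = a \<bullet> u"
    using inner_matrix_vector_mult_sym[OF sym_posdef_matrix_inv(3)[OF assms], of "S *v a" u] GS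
    by (simp add: inner_commute)
  have "(u - S *v a) \<bullet> (?G *v (u - S *v a))
      = u \<bullet> (?G *v u) - u \<bullet> a - (S *v a) \<bullet> (?G *v u) + (S *v a) \<bullet> a"
    by (simp add: matrix_vector_mult_diff_distrib GS inner_diff_left inner_diff_right)
  also have "\<dots> = u \<bullet> (?G *v u) - 2 * (a \<bullet> u) + a \<bullet> (S *v a)"
    unfolding cross by (simp add: inner_commute[of u a] inner_commute[of "S *v a" a])
  finally have "- (1/2) * ((u - S *v a) \<bullet> (?G *v (u - S *v a)))
      = - (1/2) * (u \<bullet> (?G *v u)) + (a \<bullet> u - a \<bullet> (S *v a) / 2)"
    by (simp add: field_simps)
  then show ?thesis unfolding gauss_pdf_def diff_zero by (simp only: exp_add) simp
qed

lemma ln_gauss_pdf: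
  fixes S :: "real^'n^'n"
  assumes "det S > 0"
  shows "ln (gauss_pdf S m u)
    = - ((u - m) \<bullet> (matrix_inv S *v (u - m))) / 2 - ln ((2 * pi) ^ CARD('n) * det S) / 2"
  using assms unfolding gauss_pdf_def by (simp add: ln_div ln_sqrt)

lemma (in prob_space) det_pos_if_gaussian:
  assumes "distributed M lborel X (\<lambda>u. ennreal (gauss_pdf S 0 u))"
  shows "det S > 0"
proof (rule ccontr)
  assume "\<not> det S > 0"
  then have "gauss_pdf S 0 u \<le> 0" for u
    unfolding gauss_pdf_def by (simp add: divide_nonneg_nonpos mult_nonneg_nonpos)
  then have "(\<integral>\<^sup>+u. ennreal (gauss_pdf S 0 u) \<partial>lborel) = 0"
    by (simp add: ennreal_neg)
  moreover have "(\<integral>\<^sup>+u. ennreal (gauss_pdf S 0 u) * 1 \<partial>lborel) = (\<integral>\<^sup>+\<omega>. 1 \<partial>M)"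
    by (rule distributed_nn_integral[OF assms]) simp
  ultimately show False by (simp add: emeasure_space_1)
qed

lemma (in prob_space) gaussian_mgf:
  fixes X :: "'a \<Rightarrow> real^'n"
  assumes S: "sym_posdef S" and X: "distributed M lborel X (\<lambda>u. ennreal (gauss_pdf S 0 u))"
  shows "(\<integral>\<^sup>+\<omega>. exp (a \<bullet> X \<omega>) \<partial>M) = exp (a \<bullet> (S *v a) / 2)"
proof -
  let ?f = "\<lambda>u. ennreal (gauss_pdf S 0 u)"
  have [measurable]: "?f \<in> borel_measurable lborel" using X by (rule distributed_borel_measurable)
  have "gauss_pdf S 0 u \<ge> 0" for u
    unfolding gauss_pdf_def using det_pos_if_gaussian[OF X] by simp
  moreover have "exp (a \<bullet> u - a \<bullet> (S *v a) / 2) = exp (- (a \<bullet> (S *v a)) / 2) * exp (a \<bullet> u)" for u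
    by (subst exp_add[symmetric]) simp
  ultimately have shift:
    "?f (- (S *v a) + u) = ennreal (exp (- (a \<bullet> (S *v a)) / 2)) * (?f u * exp (a \<bullet> u))" for u
    using gauss_pdf_shift[OF S, of u a] by (simp add: ennreal_mult mult_ac)
  have "1 = (\<integral>\<^sup>+u. ?f u \<partial>lborel)"
    using distributed_nn_integral[OF X, of "\<lambda>_. 1"] by (simp add: emeasure_space_1)
  also have "\<dots> = (\<integral>\<^sup>+u. ?f (- (S *v a) + u) \<partial>lborel)"
    by (subst lborel_distr_plus[symmetric, of "- (S *v a)"]) (simp add: nn_integral_distr)
  also have "\<dots> = ennreal (exp (- (a \<bullet> (S *v a)) / 2)) * (\<integral>\<^sup>+u. ?f u * exp (a \<bullet> u) \<partial>lborel)"
    unfolding shift by (rule nn_integral_cmult) measurable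
  also have "(\<integral>\<^sup>+u. ?f u * exp (a \<bullet> u) \<partial>lborel) = (\<integral>\<^sup>+\<omega>. exp (a \<bullet> X \<omega>) \<partial>M)"
    by (rule distributed_nn_integral[OF X]) measurable
  finally have "ennreal (exp (a \<bullet> (S *v a) / 2)) * 1
      = ennreal (exp (a \<bullet> (S *v a) / 2)) * ennreal (exp (- (a \<bullet> (S *v a)) / 2))
        * (\<integral>\<^sup>+\<omega>. exp (a \<bullet> X \<omega>) \<partial>M)"
    by (simp add: mult.assoc)
  also have "ennreal (exp (a \<bullet> (S *v a) / 2)) * ennreal (exp (- (a \<bullet> (S *v a)) / 2)) = 1"
    by (simp flip: ennreal_mult exp_add)
  finally show ?thesis by simp
qed

lemma (in prob_space) gaussian_inner_moments:
  fixes X :: "'a \<Rightarrow> real^'n"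
  assumes S: "sym_posdef S" and X: "distributed M lborel X (\<lambda>u. ennreal (gauss_pdf S 0 u))"
  shows "integrable M (\<lambda>\<omega>. a \<bullet> X \<omega>)" "expectation (\<lambda>\<omega>. a \<bullet> X \<omega>) = 0"
    "integrable M (\<lambda>\<omega>. (a \<bullet> X \<omega>)\<^sup>2)" "expectation (\<lambda>\<omega>. (a \<bullet> X \<omega>)\<^sup>2) = a \<bullet> (S *v a)"
proof -
  have [measurable]: "X \<in> borel_measurable M" using X unfolding distributed_def by auto
  have "(\<integral>\<^sup>+\<omega>. exp (c * (a \<bullet> X \<omega>)) \<partial>M) = ennreal (exp (c\<^sup>2 * (a \<bullet> (S *v a)) / 2))" for c
    using gaussian_mgf[OF S X, of "c *\<^sub>R a"]
    by (simp add: matrix_vector_mult_scaleR power2_eq_square mult_ac)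
  then have exp_int: "integrable M (\<lambda>\<omega>. exp (c * (a \<bullet> X \<omega>)))"
    and exp_mgf: "expectation (\<lambda>\<omega>. exp (c * (a \<bullet> X \<omega>))) = exp (c\<^sup>2 * (a \<bullet> (S *v a)) / 2)" for c
    by (subst (asm) nn_integral_eq_integrable; simp)+
  have "(\<lambda>\<omega>. a \<bullet> X \<omega>) \<in> borel_measurable M" by measurable
  from moments_of_gaussian_mgf[OF this exp_int exp_mgf]
  show "integrable M (\<lambda>\<omega>. a \<bullet> X \<omega>)" "expectation (\<lambda>\<omega>. a \<bullet> X \<omega>) = 0"
    "integrable M (\<lambda>\<omega>. (a \<bullet> X \<omega>)\<^sup>2)" "expectation (\<lambda>\<omega>. (a \<bullet> X \<omega>)\<^sup>2) = a \<bullet> (S *v a)"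
    by simp_all
qed

definition centered_cov :: "'a measure \<Rightarrow> ('a \<Rightarrow> real^'n) \<Rightarrow> real^'n^'n \<Rightarrow> bool" where
  "centered_cov M V C \<longleftrightarrow>
     (\<forall>i. integrable M (\<lambda>\<omega>. V \<omega> $ i) \<and> integral\<^sup>L M (\<lambda>\<omega>. V \<omega> $ i) = 0) \<and>
     (\<forall>i j. integrable M (\<lambda>\<omega>. V \<omega> $ i * V \<omega> $ j) \<and>
        integral\<^sup>L M (\<lambda>\<omega>. V \<omega> $ i * V \<omega> $ j) = C $ i $ j)"

lemma (in prob_space) centered_cov_gaussian:
  fixes X :: "'a \<Rightarrow> real^'n"
  assumes S: "sym_posdef S" and X: "distributed M lborel X (\<lambda>u. ennreal (gauss_pdf S 0 u))"
  shows "centered_cov M X S"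
proof -
  have S_comm: "S $ j $ i = S $ i $ j" for i j
    using S unfolding sym_posdef_def by (metis transpose_def vec_lambda_beta)
  have comp: "X \<omega> $ k = axis k 1 \<bullet> X \<omega>" for \<omega> k by (simp add: inner_axis')
  note mom = gaussian_inner_moments[OF S X]
  have polar: "X \<omega> $ i * X \<omega> $ j = ((axis i 1 + axis j 1) \<bullet> X \<omega>)\<^sup>2 / 2
      - (axis i 1 \<bullet> X \<omega>)\<^sup>2 / 2 - (axis j 1 \<bullet> X \<omega>)\<^sup>2 / 2" for \<omega> i j
    unfolding comp by (simp add: inner_add_left power2_eq_square field_simps)
  have "expectation (\<lambda>\<omega>. X \<omega> $ i * X \<omega> $ j)
      = ((axis i 1 + axis j 1) \<bullet> (S *v (axis i 1 + axis j 1))) / 2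
        - (axis i 1 \<bullet> (S *v axis i 1)) / 2 - (axis j 1 \<bullet> (S *v axis j 1)) / 2" for i j
    unfolding polar using mom by simp
  also have "\<dots> i j = S $ i $ j" for i j
    by (simp add: matrix_vector_right_distrib inner_add_left inner_add_right inner_axis'
        matrix_vector_mult_basis column_def S_comm field_simps)
  finally have "expectation (\<lambda>\<omega>. X \<omega> $ i * X \<omega> $ j) = S $ i $ j" for i j .
  moreover have "integrable M (\<lambda>\<omega>. X \<omega> $ i * X \<omega> $ j)" for i j
    unfolding polar using mom by simp
  moreover have "integrable M (\<lambda>\<omega>. X \<omega> $ i)" "expectation (\<lambda>\<omega>. X \<omega> $ i) = 0" for i
    using mom(1,2)[of "axis i 1"] by (simp_all add: inner_axis')
  ultimately show ?thesis unfolding centered_cov_def by simp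
qed

lemma (in prob_space) centered_cov_inner:
  fixes V :: "'a \<Rightarrow> real^'n"
  assumes "centered_cov M V C"
  shows "integrable M (\<lambda>\<omega>. V \<omega> \<bullet> c)" "expectation (\<lambda>\<omega>. V \<omega> \<bullet> c) = 0"
    "integrable M (\<lambda>\<omega>. (V \<omega> \<bullet> c) * (V \<omega> \<bullet> d))"
    "expectation (\<lambda>\<omega>. (V \<omega> \<bullet> c) * (V \<omega> \<bullet> d)) = c \<bullet> (C *v d)"
    "integrable M (\<lambda>\<omega>. V \<omega> \<bullet> (R *v V \<omega>))"
    "expectation (\<lambda>\<omega>. V \<omega> \<bullet> (R *v V \<omega>)) = trace (transpose C ** R)"
proof -
  note mom = assms[unfolded centered_cov_def]
  have lin: "V \<omega> \<bullet> e = (\<Sum>i\<in>UNIV. e $ i * V \<omega> $ i)" for \<omega> e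
    by (simp add: inner_vec_def mult.commute)
  have bilin: "(V \<omega> \<bullet> c) * (V \<omega> \<bullet> d) = (\<Sum>i\<in>UNIV. \<Sum>j\<in>UNIV. (c $ i * d $ j) * (V \<omega> $ i * V \<omega> $ j))"
    for \<omega> unfolding lin sum_product by (simp add: mult_ac)
  have quad: "V \<omega> \<bullet> (R *v V \<omega>) = (\<Sum>i\<in>UNIV. \<Sum>j\<in>UNIV. R $ i $ j * (V \<omega> $ i * V \<omega> $ j))" for \<omega>
    by (simp add: inner_vec_def matrix_vector_mult_def sum_distrib_left mult_ac)
  show "integrable M (\<lambda>\<omega>. V \<omega> \<bullet> c)" "expectation (\<lambda>\<omega>. V \<omega> \<bullet> c) = 0"
    unfolding lin using mom by auto
  show "integrable M (\<lambda>\<omega>. (V \<omega> \<bullet> c) * (V \<omega> \<bullet> d))"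
    unfolding bilin using mom by auto
  show "integrable M (\<lambda>\<omega>. V \<omega> \<bullet> (R *v V \<omega>))"
    unfolding quad using mom by auto
  show "expectation (\<lambda>\<omega>. (V \<omega> \<bullet> c) * (V \<omega> \<bullet> d)) = c \<bullet> (C *v d)"
    unfolding bilin using mom
    by (simp add: inner_vec_def matrix_vector_mult_def sum_distrib_left mult_ac)
  show "expectation (\<lambda>\<omega>. V \<omega> \<bullet> (R *v V \<omega>)) = trace (transpose C ** R)"
    unfolding quad trace_transpose_mult using mom by (simp add: mult.commute)
qed

section \<open>Independent noise\<close>

lemma Int_stable_vimage_borel:
  fixes f :: "'a \<Rightarrow> 'b::topological_space"
  shows "Int_stable {f -` A \<inter> \<Omega> | A. A \<in> sets (borel :: 'b measure)}"
  unfolding Int_stable_def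
proof safe
  fix A B :: "'b set" assume "A \<in> sets borel" "B \<in> sets borel"
  then show "\<exists>C. (f -` A \<inter> \<Omega>) \<inter> (f -` B \<inter> \<Omega>) = f -` C \<inter> \<Omega> \<and> C \<in> sets borel"
    by (intro exI[of _ "A \<inter> B"]) auto
qed

locale lqr_noise = prob_space M for M :: "'a measure" +
  fixes wx :: "nat \<Rightarrow> 'a \<Rightarrow> real" and wu xi :: "nat \<Rightarrow> 'a \<Rightarrow> real^'n"
  assumes wx_measurable [measurable]: "\<And>t. wx t \<in> borel_measurable M"
    and wu_measurable [measurable]: "\<And>t. wu t \<in> borel_measurable M"
    and xi_measurable [measurable]: "\<And>t. xi t \<in> borel_measurable M"
    and indep_noise: "indep_sets (noise_events M wx wu xi) (UNIV \<times> {0, 1, 2})"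
begin

definition noise_sigma :: "(nat \<times> nat) set \<Rightarrow> 'a measure" where
  "noise_sigma J = sigma (space M) (\<Union>j\<in>J. noise_events M wx wu xi j)"

lemma noise_events_subset_events: "noise_events M wx wu xi j \<subseteq> events"
  by (cases j) (auto simp: noise_events_def intro!: measurable_sets)

lemma sets_noise_sigma:
  "sets (noise_sigma J) = sigma_sets (space M) (\<Union>j\<in>J. noise_events M wx wu xi j)"
  unfolding noise_sigma_def using noise_events_subset_events sets.sets_into_space
  by (subst sets_measure_of) blast+

lemma space_noise_sigma [simp]: "space (noise_sigma J) = space M"
  unfolding noise_sigma_def using noise_events_subset_events sets.sets_into_space
  by (subst space_measure_of_conv) blast+

lemma measurable_noise_sigma_mono:
  assumes "J \<subseteq> J'" "f \<in> borel_measurable (noise_sigma J)"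
  shows "f \<in> borel_measurable (noise_sigma J')"
proof (rule measurable_from_subalg[OF _ assms(2)])
  show "subalgebra (noise_sigma J') (noise_sigma J)"
    unfolding subalgebra_def sets_noise_sigma using assms(1)
    by (auto intro!: sigma_sets_subseteq)
qed

lemma measurable_noise_sigma_M:
  assumes "f \<in> borel_measurable (noise_sigma J)"
  shows "f \<in> borel_measurable M"
proof (rule measurable_from_subalg[OF _ assms])
  show "subalgebra M (noise_sigma J)"
    unfolding subalgebra_def sets_noise_sigma using noise_events_subset_events
    by (auto intro!: sets.sigma_sets_subset)
qed

lemma measurable_noise_sigma_generator:
  assumes "j \<in> J" "\<And>A. A \<in> sets borel \<Longrightarrow> f -` A \<inter> space M \<in> noise_events M wx wu xi j"
  shows "f \<in> borel_measurable (noise_sigma J)"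
proof (rule measurableI)
  fix A :: "'b set" assume "A \<in> sets borel"
  with assms show "f -` A \<inter> space (noise_sigma J) \<in> sets (noise_sigma J)"
    unfolding sets_noise_sigma by auto
qed simp

lemma wx_measurable_noise_sigma: "(t, 0) \<in> J \<Longrightarrow> wx t \<in> borel_measurable (noise_sigma J)"
  by (rule measurable_noise_sigma_generator[of "(t, 0)"]) (auto simp: noise_events_def)

lemma wu_measurable_noise_sigma: "(t, 1) \<in> J \<Longrightarrow> wu t \<in> borel_measurable (noise_sigma J)"
  by (rule measurable_noise_sigma_generator[of "(t, 1)"]) (auto simp: noise_events_def)

lemma xi_measurable_noise_sigma: "(t, 2) \<in> J \<Longrightarrow> xi t \<in> borel_measurable (noise_sigma J)"
  by (rule measurable_noise_sigma_generator[of "(t, 2)"]) (auto simp: noise_events_def)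

lemma indep_noise_sigma:
  assumes J: "J1 \<subseteq> UNIV \<times> {0, 1, 2}" "J2 \<subseteq> UNIV \<times> {0, 1, 2}" "J1 \<inter> J2 = {}"
    and X: "X \<in> borel_measurable (noise_sigma J1)" and Y: "Y \<in> borel_measurable (noise_sigma J2)"
  shows "indep_var borel X borel Y"
proof -
  define I where "I b = (if b then J1 else J2)" for b
  have "indep_sets (\<lambda>b. sigma_sets (space M) (\<Union>j\<in>I b. noise_events M wx wu xi j)) UNIV"
  proof (rule indep_sets_collect_sigma)
    show "indep_sets (noise_events M wx wu xi) (\<Union>b\<in>UNIV. I b)"
      by (rule indep_sets_mono_index[OF _ indep_noise]) (use J in \<open>auto simp: I_def\<close>)
    show "Int_stable (noise_events M wx wu xi j)" for j
      by (cases j) (auto simp: noise_events_def Int_stable_vimage_borel)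
    show "disjoint_family_on I UNIV"
      using J unfolding disjoint_family_on_def I_def by auto
  qed
  then have "indep_sets (\<lambda>b. sets (noise_sigma (I b))) UNIV"
    by (simp add: sets_noise_sigma)
  then have "indep_sets (\<lambda>b. sigma_sets (space M)
      {case_bool X Y b -` A \<inter> space M | A. A \<in> sets (case_bool borel borel b)}) UNIV"
  proof (rule indep_sets_mono_sets)
    fix b :: bool
    have "{case_bool X Y b -` A \<inter> space M | A. A \<in> sets (case_bool borel borel b)}
        \<subseteq> sets (noise_sigma (I b))"
      using measurable_sets[OF X] measurable_sets[OF Y] by (cases b) (auto simp: I_def)
    from sets.sigma_sets_subset[OF this] show "sigma_sets (space M)
        {case_bool X Y b -` A \<inter> space M | A. A \<in> sets (case_bool borel borel b)}
        \<subseteq> sets (noise_sigma (I b))"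
      by simp
  qed
  moreover have "random_variable (case_bool borel borel b) (case_bool X Y b)" for b
    using measurable_noise_sigma_M[OF X] measurable_noise_sigma_M[OF Y] by (cases b) auto
  ultimately show ?thesis
    unfolding indep_var_def indep_vars_def by blast
qed

lemma indep_noise_integral_mult:
  fixes X Y :: "'a \<Rightarrow> real"
  assumes "J1 \<subseteq> UNIV \<times> {0, 1, 2}" "J2 \<subseteq> UNIV \<times> {0, 1, 2}" "J1 \<inter> J2 = {}"
    and "X \<in> borel_measurable (noise_sigma J1)" "Y \<in> borel_measurable (noise_sigma J2)"
    and "integrable M X" "integrable M Y"
  shows "integrable M (\<lambda>\<omega>. X \<omega> * Y \<omega>)"
    "expectation (\<lambda>\<omega>. X \<omega> * Y \<omega>) = expectation X * expectation Y"
  using indep_noise_sigma[OF assms(1-5)] assms(6,7)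
  by (auto intro: indep_var_integrable indep_var_lebesgue_integral)

end

section \<open>Second moments of the closed-loop state\<close>

lemma V_K_eq: "V_K A C B D K = (A - B \<bullet> K)\<^sup>2 + C\<^sup>2 + (D *v K) \<bullet> (D *v K)"
proof -
  have "outer B B *v K = (B \<bullet> K) *\<^sub>R B"
    by (simp add: vec_eq_iff outer_def matrix_vector_mult_def inner_vec_def sum_distrib_left mult_ac)
  moreover have "K \<bullet> ((transpose D ** D) *v K) = (D *v K) \<bullet> (D *v K)"
  proof -
    have "K \<bullet> ((transpose D ** D) *v K) = ((D *v K) v* D) \<bullet> K"
      by (simp add: inner_commute flip: matrix_vector_mul_assoc)
    then show ?thesis by (simp add: dot_lmul_matrix)
  qed
  ultimately show ?thesis
    unfolding V_K_def
    by (simp add: matrix_vector_mult_add_rdistrib inner_add_right power2_eq_square inner_commute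
        algebra_simps)
qed

locale lqr_closed_loop = lqr_noise M wx wu xi
  for M :: "'a measure" and wx :: "nat \<Rightarrow> 'a \<Rightarrow> real" and wu xi :: "nat \<Rightarrow> 'a \<Rightarrow> real^'n" +
  fixes A C :: real and B :: "real^'n" and D :: "real^'n^'n" and K :: "real^'n"
    and S :: "real^'n^'n" and x0 :: real
  assumes S_posdef: "sym_posdef S"
    and wx_int: "\<And>t. integrable M (wx t)" "\<And>t. integrable M (\<lambda>\<omega>. (wx t \<omega>)\<^sup>2)"
    and wx_mom: "\<And>t. integral\<^sup>L M (wx t) = 0" "\<And>t. integral\<^sup>L M (\<lambda>\<omega>. (wx t \<omega>)\<^sup>2) = 1"
    and wu_int: "\<And>t i. integrable M (\<lambda>\<omega>. wu t \<omega> $ i)"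
      "\<And>t i j. integrable M (\<lambda>\<omega>. wu t \<omega> $ i * wu t \<omega> $ j)"
    and wu_mom: "\<And>t i. integral\<^sup>L M (\<lambda>\<omega>. wu t \<omega> $ i) = 0"
      "\<And>t i j. integral\<^sup>L M (\<lambda>\<omega>. wu t \<omega> $ i * wu t \<omega> $ j) = (if i = j then 1 else 0)"
    and xi_gauss: "\<And>t. distributed M lborel (xi t) (\<lambda>u. ennreal (gauss_pdf S 0 u))"
begin

abbreviation "state \<equiv> ctrl_state A C B D K wx wu xi x0"

lemma S_sym: "transpose S = S"
  using S_posdef unfolding sym_posdef_def by simp

lemma wu_inner_moments:
  "integrable M (\<lambda>\<omega>. wu t \<omega> \<bullet> c)" "expectation (\<lambda>\<omega>. wu t \<omega> \<bullet> c) = 0"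
  "integrable M (\<lambda>\<omega>. (wu t \<omega> \<bullet> c) * (wu t \<omega> \<bullet> d))"
  "expectation (\<lambda>\<omega>. (wu t \<omega> \<bullet> c) * (wu t \<omega> \<bullet> d)) = c \<bullet> d"
proof -
  have "centered_cov M (wu t) (mat 1)"
    unfolding centered_cov_def using wu_int wu_mom by (simp add: mat_def)
  from centered_cov_inner[OF this] show
    "integrable M (\<lambda>\<omega>. wu t \<omega> \<bullet> c)" "expectation (\<lambda>\<omega>. wu t \<omega> \<bullet> c) = 0"
    "integrable M (\<lambda>\<omega>. (wu t \<omega> \<bullet> c) * (wu t \<omega> \<bullet> d))"
    "expectation (\<lambda>\<omega>. (wu t \<omega> \<bullet> c) * (wu t \<omega> \<bullet> d)) = c \<bullet> d"
    by simp_all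
qed

lemmas xi_centered_cov = centered_cov_gaussian[OF S_posdef xi_gauss]
lemmas xi_inner_moments = centered_cov_inner[OF xi_centered_cov, unfolded S_sym]

definition past :: "nat \<Rightarrow> (nat \<times> nat) set" where
  "past t = {..<t} \<times> {0, 1, 2}"

lemma state_measurable_past: "state t \<in> borel_measurable (noise_sigma (past t))"
proof (induction t)
  case (Suc t)
  have [measurable]: "state t \<in> borel_measurable (noise_sigma (past (Suc t)))"
    by (rule measurable_noise_sigma_mono[OF _ Suc]) (auto simp: past_def)
  have [measurable]: "wx t \<in> borel_measurable (noise_sigma (past (Suc t)))"
    "wu t \<in> borel_measurable (noise_sigma (past (Suc t)))"
    "xi t \<in> borel_measurable (noise_sigma (past (Suc t)))"
    by (auto intro!: wx_measurable_noise_sigma wu_measurable_noise_sigma xi_measurable_noise_sigma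
        simp: past_def)
  show ?case by (simp add: Let_def) measurable
qed simp

lemma state_measurable [measurable]: "state t \<in> borel_measurable M"
  by (rule measurable_noise_sigma_M[OF state_measurable_past])

definition input_gain :: "nat \<Rightarrow> 'a \<Rightarrow> real^'n" where
  "input_gain t \<omega> = B + wu t \<omega> v* D"

definition gain :: "nat \<Rightarrow> 'a \<Rightarrow> real" where
  "gain t \<omega> = A + wx t \<omega> * C - input_gain t \<omega> \<bullet> K"

lemma state_Suc: "state (Suc t) \<omega> = gain t \<omega> * state t \<omega> + input_gain t \<omega> \<bullet> xi t \<omega>"
  by (simp add: Let_def gain_def input_gain_def inner_diff_right algebra_simps)

lemma gain_eq: "gain t \<omega> = (A - B \<bullet> K) + wx t \<omega> * C - wu t \<omega> \<bullet> (D *v K)"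
  by (simp add: gain_def input_gain_def inner_add_left dot_lmul_matrix)

lemma input_gain_nth: "input_gain t \<omega> $ j = B $ j + wu t \<omega> \<bullet> column j D"
  by (simp add: input_gain_def vector_matrix_mult_nth)

lemma gain_measurable: "gain t \<in> borel_measurable (noise_sigma {(t, 0), (t, 1)})"
proof -
  have [measurable]: "wx t \<in> borel_measurable (noise_sigma {(t, 0), (t, 1)})"
    "wu t \<in> borel_measurable (noise_sigma {(t, 0), (t, 1)})"
    by (auto intro: wx_measurable_noise_sigma wu_measurable_noise_sigma)
  show ?thesis unfolding gain_eq[abs_def] by measurable
qed

lemma input_gain_measurable:
  "(\<lambda>\<omega>. input_gain t \<omega> $ j) \<in> borel_measurable (noise_sigma J)" if "(t, 1) \<in> J"
proof -
  have [measurable]: "wu t \<in> borel_measurable (noise_sigma J)"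
    using that by (rule wu_measurable_noise_sigma)
  show ?thesis unfolding input_gain_nth by measurable
qed

lemma wx_wu_uncorrelated:
  "integrable M (\<lambda>\<omega>. wx t \<omega> * (wu t \<omega> \<bullet> c))" "expectation (\<lambda>\<omega>. wx t \<omega> * (wu t \<omega> \<bullet> c)) = 0"
proof -
  have [measurable]: "wu t \<in> borel_measurable (noise_sigma {(t, 1)})"
    by (auto intro: wu_measurable_noise_sigma)
  have wx: "wx t \<in> borel_measurable (noise_sigma {(t, 0)})"
    by (rule wx_measurable_noise_sigma) simp
  have wu: "(\<lambda>\<omega>. wu t \<omega> \<bullet> c) \<in> borel_measurable (noise_sigma {(t, 1)})"
    by measurable
  from indep_noise_integral_mult[OF _ _ _ wx wu wx_int(1) wu_inner_moments(1)]
  show "integrable M (\<lambda>\<omega>. wx t \<omega> * (wu t \<omega> \<bullet> c))"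
    "expectation (\<lambda>\<omega>. wx t \<omega> * (wu t \<omega> \<bullet> c)) = 0"
    by (simp_all add: wx_mom)
qed

lemma gain_sq_moment:
  "integrable M (\<lambda>\<omega>. (gain t \<omega>)\<^sup>2)" "expectation (\<lambda>\<omega>. (gain t \<omega>)\<^sup>2) = V_K A C B D K"
proof -
  let ?a = "A - B \<bullet> K" and ?w = "\<lambda>\<omega>. wu t \<omega> \<bullet> (D *v K)"
  have sq: "(gain t \<omega>)\<^sup>2 = ?a\<^sup>2 + C\<^sup>2 * (wx t \<omega>)\<^sup>2 + ?w \<omega> * ?w \<omega> + (2 * ?a * C) * wx t \<omega>
      - (2 * ?a) * ?w \<omega> - (2 * C) * (wx t \<omega> * ?w \<omega>)" for \<omega>
    unfolding gain_eq by (simp add: power2_eq_square algebra_simps)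
  show "integrable M (\<lambda>\<omega>. (gain t \<omega>)\<^sup>2)"
    unfolding sq using wx_int wu_inner_moments wx_wu_uncorrelated by simp
  show "expectation (\<lambda>\<omega>. (gain t \<omega>)\<^sup>2) = V_K A C B D K"
    unfolding sq V_K_eq using wx_int wx_mom wu_inner_moments wx_wu_uncorrelated
    by (simp add: prob_space)
qed

lemma input_gain_moments:
  "integrable M (\<lambda>\<omega>. input_gain t \<omega> $ j * input_gain t \<omega> $ k)"
  "expectation (\<lambda>\<omega>. input_gain t \<omega> $ j * input_gain t \<omega> $ k) = (outer B B + transpose D ** D) $ j $ k"
proof -
  have prod: "input_gain t \<omega> $ j * input_gain t \<omega> $ k = B $ j * B $ k + B $ j * (wu t \<omega> \<bullet> column k D)
      + B $ k * (wu t \<omega> \<bullet> column j D) + (wu t \<omega> \<bullet> column j D) * (wu t \<omega> \<bullet> column k D)" for \<omega>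
    unfolding input_gain_nth by (simp add: algebra_simps)
  show "integrable M (\<lambda>\<omega>. input_gain t \<omega> $ j * input_gain t \<omega> $ k)"
    unfolding prod using wu_inner_moments by simp
  show "expectation (\<lambda>\<omega>. input_gain t \<omega> $ j * input_gain t \<omega> $ k) = (outer B B + transpose D ** D) $ j $ k"
    unfolding prod using wu_inner_moments
    by (simp add: prob_space outer_def transpose_mult_self_nth)
qed

lemma gain_input_gain_integrable: "integrable M (\<lambda>\<omega>. gain t \<omega> * input_gain t \<omega> $ j)"
proof -
  have "gain t \<omega> * input_gain t \<omega> $ j = (A - B \<bullet> K) * B $ j + (A - B \<bullet> K) * (wu t \<omega> \<bullet> column j D)
      + (C * B $ j) * wx t \<omega> + C * (wx t \<omega> * (wu t \<omega> \<bullet> column j D))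
      - B $ j * (wu t \<omega> \<bullet> (D *v K)) - (wu t \<omega> \<bullet> (D *v K)) * (wu t \<omega> \<bullet> column j D)" for \<omega>
    unfolding gain_eq input_gain_nth by (simp add: algebra_simps)
  then show ?thesis using wx_int wu_inner_moments wx_wu_uncorrelated by simp
qed

lemma input_noise_sq_moment:
  "integrable M (\<lambda>\<omega>. (input_gain t \<omega> \<bullet> xi t \<omega>)\<^sup>2)"
  "expectation (\<lambda>\<omega>. (input_gain t \<omega> \<bullet> xi t \<omega>)\<^sup>2) = trace (S ** (outer B B + transpose D ** D))"
proof -
  have sq: "(input_gain t \<omega> \<bullet> xi t \<omega>)\<^sup>2 = (\<Sum>j\<in>UNIV. \<Sum>k\<in>UNIV.
      (input_gain t \<omega> $ j * input_gain t \<omega> $ k) * (xi t \<omega> $ j * xi t \<omega> $ k))" for \<omega>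
    unfolding inner_vec_def power2_eq_square sum_product by (simp add: mult_ac)
  have [measurable]: "xi t \<in> borel_measurable (noise_sigma {(t, 2)})"
    by (rule xi_measurable_noise_sigma) simp
  have "(\<lambda>\<omega>. input_gain t \<omega> $ j * input_gain t \<omega> $ k) \<in> borel_measurable (noise_sigma {(t, 1)})"
    "(\<lambda>\<omega>. xi t \<omega> $ j * xi t \<omega> $ k) \<in> borel_measurable (noise_sigma {(t, 2)})" for j k
    using input_gain_measurable[of t "{(t, 1)}"] by measurable
  from indep_noise_integral_mult[OF _ _ _ this input_gain_moments(1)]
  have terms: "integrable M (\<lambda>\<omega>. (input_gain t \<omega> $ j * input_gain t \<omega> $ k) * (xi t \<omega> $ j * xi t \<omega> $ k))"
    "expectation (\<lambda>\<omega>. (input_gain t \<omega> $ j * input_gain t \<omega> $ k) * (xi t \<omega> $ j * xi t \<omega> $ k))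
      = (outer B B + transpose D ** D) $ j $ k * S $ j $ k" for j k
    using xi_centered_cov by (simp_all add: centered_cov_def input_gain_moments(2))
  show "integrable M (\<lambda>\<omega>. (input_gain t \<omega> \<bullet> xi t \<omega>)\<^sup>2)"
    unfolding sq using terms by simp
  have "expectation (\<lambda>\<omega>. (input_gain t \<omega> \<bullet> xi t \<omega>)\<^sup>2) = trace (transpose S ** (outer B B + transpose D ** D))"
    unfolding sq trace_transpose_mult using terms by (simp add: mult.commute)
  then show "expectation (\<lambda>\<omega>. (input_gain t \<omega> \<bullet> xi t \<omega>)\<^sup>2) = trace (S ** (outer B B + transpose D ** D))"
    by (simp add: S_sym)
qed

lemma state_gain_input_noise_uncorrelated:
  assumes "integrable M (state t)"
  shows "integrable M (\<lambda>\<omega>. state t \<omega> * gain t \<omega> * (input_gain t \<omega> \<bullet> xi t \<omega>))"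
    "expectation (\<lambda>\<omega>. state t \<omega> * gain t \<omega> * (input_gain t \<omega> \<bullet> xi t \<omega>)) = 0"
proof -
  define J where "J = past t \<union> {(t, 0), (t, 1)}"
  let ?c = "\<lambda>j \<omega>. state t \<omega> * (gain t \<omega> * input_gain t \<omega> $ j)"
  have sum: "state t \<omega> * gain t \<omega> * (input_gain t \<omega> \<bullet> xi t \<omega>) = (\<Sum>j\<in>UNIV. ?c j \<omega> * xi t \<omega> $ j)" for \<omega>
    unfolding inner_vec_def sum_distrib_left by (simp add: mult_ac)
  have [measurable]: "state t \<in> borel_measurable (noise_sigma J)"
    by (rule measurable_noise_sigma_mono[OF _ state_measurable_past]) (auto simp: J_def)
  have [measurable]: "gain t \<in> borel_measurable (noise_sigma J)"
    by (rule measurable_noise_sigma_mono[OF _ gain_measurable]) (auto simp: J_def)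
  have [measurable]: "(\<lambda>\<omega>. input_gain t \<omega> $ j) \<in> borel_measurable (noise_sigma J)" for j
    by (rule input_gain_measurable) (simp add: J_def)
  have [measurable]: "xi t \<in> borel_measurable (noise_sigma {(t, 2)})"
    by (rule xi_measurable_noise_sigma) simp
  have "(\<lambda>\<omega>. gain t \<omega> * input_gain t \<omega> $ j) \<in> borel_measurable (noise_sigma {(t, 0), (t, 1)})" for j
    using gain_measurable input_gain_measurable[of t "{(t, 0), (t, 1)}"] by measurable
  from indep_noise_integral_mult(1)[OF _ _ _ state_measurable_past this assms gain_input_gain_integrable]
  have c_int: "integrable M (?c j)" for j
    by (auto simp: past_def)
  have c_meas: "?c j \<in> borel_measurable (noise_sigma J)" for j
    by measurable
  have xi_meas: "(\<lambda>\<omega>. xi t \<omega> $ j) \<in> borel_measurable (noise_sigma {(t, 2)})" for j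
    by measurable
  have J: "J \<subseteq> UNIV \<times> {0, 1, 2}" "{(t, 2)} \<subseteq> UNIV \<times> {0, 1, 2}" "J \<inter> {(t, 2)} = {}"
    by (auto simp: J_def past_def)
  from indep_noise_integral_mult[OF J c_meas xi_meas c_int]
  have "integrable M (\<lambda>\<omega>. ?c j \<omega> * xi t \<omega> $ j)" "expectation (\<lambda>\<omega>. ?c j \<omega> * xi t \<omega> $ j) = 0" for j
    using xi_centered_cov by (simp_all add: centered_cov_def)
  then show "integrable M (\<lambda>\<omega>. state t \<omega> * gain t \<omega> * (input_gain t \<omega> \<bullet> xi t \<omega>))"
    "expectation (\<lambda>\<omega>. state t \<omega> * gain t \<omega> * (input_gain t \<omega> \<bullet> xi t \<omega>)) = 0"
    unfolding sum by simp_all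
qed

lemma state_sq_Suc:
  assumes "integrable M (\<lambda>\<omega>. (state t \<omega>)\<^sup>2)"
  shows "integrable M (\<lambda>\<omega>. (state (Suc t) \<omega>)\<^sup>2)"
    "expectation (\<lambda>\<omega>. (state (Suc t) \<omega>)\<^sup>2)
      = V_K A C B D K * expectation (\<lambda>\<omega>. (state t \<omega>)\<^sup>2) + trace (S ** (outer B B + transpose D ** D))"
proof -
  have sq: "(state (Suc t) \<omega>)\<^sup>2 = (state t \<omega>)\<^sup>2 * (gain t \<omega>)\<^sup>2
      + 2 * (state t \<omega> * gain t \<omega> * (input_gain t \<omega> \<bullet> xi t \<omega>)) + (input_gain t \<omega> \<bullet> xi t \<omega>)\<^sup>2" for \<omega>
    unfolding state_Suc by (simp add: power2_eq_square algebra_simps)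
  have J: "past t \<subseteq> UNIV \<times> {0, 1, 2}" "{(t, 0), (t, 1)} \<subseteq> UNIV \<times> {0, 1, 2}"
    "past t \<inter> {(t, 0), (t, 1)} = {}"
    by (auto simp: past_def)
  have "(\<lambda>\<omega>. (state t \<omega>)\<^sup>2) \<in> borel_measurable (noise_sigma (past t))"
    "(\<lambda>\<omega>. (gain t \<omega>)\<^sup>2) \<in> borel_measurable (noise_sigma {(t, 0), (t, 1)})"
    using state_measurable_past gain_measurable by measurable
  note product = indep_noise_integral_mult[OF J this assms gain_sq_moment(1)]
  have "integrable M (state t)"
    by (rule square_integrable_imp_integrable[OF state_measurable assms])
  note cross = state_gain_input_noise_uncorrelated[OF this]
  show "integrable M (\<lambda>\<omega>. (state (Suc t) \<omega>)\<^sup>2)"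
    unfolding sq using product cross input_noise_sq_moment by simp
  show "expectation (\<lambda>\<omega>. (state (Suc t) \<omega>)\<^sup>2)
      = V_K A C B D K * expectation (\<lambda>\<omega>. (state t \<omega>)\<^sup>2) + trace (S ** (outer B B + transpose D ** D))"
    unfolding sq using product cross input_noise_sq_moment by (simp add: gain_sq_moment(2))
qed

lemma state_sq_integrable: "integrable M (\<lambda>\<omega>. (state t \<omega>)\<^sup>2)"
proof (induction t)
  case (Suc t)
  then show ?case by (rule state_sq_Suc(1))
qed simp

section \<open>Expected discounted cost\<close>

definition stage_cost :: "real \<Rightarrow> real^'n^'n \<Rightarrow> real \<Rightarrow> nat \<Rightarrow> 'a \<Rightarrow> real" where
  "stage_cost Q R \<tau> t \<omega> =
     (let x = state t \<omega>; u = ctrl_input A C B D K wx wu xi x0 t \<omega>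
      in Q * x\<^sup>2 + u \<bullet> (R *v u) + \<tau> * ln (gauss_pdf S (- (x *\<^sub>R K)) u))"

lemma det_S_pos: "det S > 0"
  by (rule det_pos_if_gaussian[OF xi_gauss])

lemma stage_cost_eq: "stage_cost Q R \<tau> t \<omega> = Q * (state t \<omega>)\<^sup>2
    + (xi t \<omega> - state t \<omega> *\<^sub>R K) \<bullet> (R *v (xi t \<omega> - state t \<omega> *\<^sub>R K))
    - \<tau> / 2 * (xi t \<omega> \<bullet> (matrix_inv S *v xi t \<omega>)) - \<tau> / 2 * ln ((2 * pi) ^ CARD('n) * det S)"
  unfolding stage_cost_def ctrl_input_def Let_def ln_gauss_pdf[OF det_S_pos]
  by (simp add: algebra_simps)

lemma state_xi_uncorrelated:
  "integrable M (\<lambda>\<omega>. state t \<omega> * (xi t \<omega> \<bullet> c))" "expectation (\<lambda>\<omega>. state t \<omega> * (xi t \<omega> \<bullet> c)) = 0"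
proof -
  have J: "past t \<subseteq> UNIV \<times> {0, 1, 2}" "{(t, 2)} \<subseteq> UNIV \<times> {0, 1, 2}" "past t \<inter> {(t, 2)} = {}"
    by (auto simp: past_def)
  have [measurable]: "xi t \<in> borel_measurable (noise_sigma {(t, 2)})"
    by (rule xi_measurable_noise_sigma) simp
  have "(\<lambda>\<omega>. xi t \<omega> \<bullet> c) \<in> borel_measurable (noise_sigma {(t, 2)})" by measurable
  moreover have "integrable M (state t)"
    by (rule square_integrable_imp_integrable[OF state_measurable state_sq_integrable])
  ultimately show "integrable M (\<lambda>\<omega>. state t \<omega> * (xi t \<omega> \<bullet> c))"
    "expectation (\<lambda>\<omega>. state t \<omega> * (xi t \<omega> \<bullet> c)) = 0"
    using indep_noise_integral_mult[OF J state_measurable_past] xi_inner_moments(1,2) by auto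
qed

lemma stage_cost_moment:
  "integrable M (stage_cost Q R \<tau> t)"
  "expectation (stage_cost Q R \<tau> t) = (Q + K \<bullet> (R *v K)) * expectation (\<lambda>\<omega>. (state t \<omega>)\<^sup>2)
     + trace (S ** R) - \<tau> / 2 * (real CARD('n) + ln ((2 * pi) ^ CARD('n) * det S))"
proof -
  have "K \<bullet> (R *v v) = v \<bullet> (K v* R)" for v
    by (simp add: dot_lmul_matrix[symmetric] inner_commute)
  then have expand: "stage_cost Q R \<tau> t \<omega> = Q * (state t \<omega>)\<^sup>2 + xi t \<omega> \<bullet> (R *v xi t \<omega>)
      - state t \<omega> * (xi t \<omega> \<bullet> (R *v K)) - state t \<omega> * (xi t \<omega> \<bullet> (K v* R))
      + (state t \<omega>)\<^sup>2 * (K \<bullet> (R *v K))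
      - \<tau> / 2 * (xi t \<omega> \<bullet> (matrix_inv S *v xi t \<omega>)) - \<tau> / 2 * ln ((2 * pi) ^ CARD('n) * det S)" for \<omega>
    unfolding stage_cost_eq
    by (simp add: matrix_vector_mult_diff_distrib matrix_vector_mult_scaleR inner_diff_left
        inner_diff_right power2_eq_square algebra_simps)
  have "trace (S ** matrix_inv S) = real CARD('n)"
    by (simp add: sym_posdef_matrix_inv(1)[OF S_posdef] trace_I)
  then show "integrable M (stage_cost Q R \<tau> t)"
    "expectation (stage_cost Q R \<tau> t) = (Q + K \<bullet> (R *v K)) * expectation (\<lambda>\<omega>. (state t \<omega>)\<^sup>2)
      + trace (S ** R) - \<tau> / 2 * (real CARD('n) + ln ((2 * pi) ^ CARD('n) * det S))"
    unfolding expand[abs_def] using state_sq_integrable xi_inner_moments state_xi_uncorrelated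
    by (simp_all add: prob_space algebra_simps)
qed

lemma abs_stage_cost_le:
  "\<bar>stage_cost Q R \<tau> t \<omega>\<bar> \<le> (\<bar>Q\<bar> + 2 * onorm ((*v) R) * (norm K)\<^sup>2) * (state t \<omega>)\<^sup>2
    + (2 * onorm ((*v) R) + \<bar>\<tau>\<bar> / 2 * onorm ((*v) (matrix_inv S))) * (norm (xi t \<omega>))\<^sup>2
    + \<bar>\<tau> / 2 * ln ((2 * pi) ^ CARD('n) * det S)\<bar>"
proof -
  let ?x = "state t \<omega>" and ?v = "xi t \<omega>" and ?cR = "onorm ((*v) R)"
  let ?u = "?v - ?x *\<^sub>R K" and ?lnZ = "ln ((2 * pi) ^ CARD('n) * det S)"
  have "0 \<le> ?cR" by (intro onorm_pos_le) simp
  have "(norm ?u)\<^sup>2 \<le> 2 * (norm ?v)\<^sup>2 + 2 * (?x\<^sup>2 * (norm K)\<^sup>2)"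
    using power2_norm_diff_le[of ?v "?x *\<^sub>R K"] by (simp add: power_mult_distrib)
  from mult_left_mono[OF this \<open>0 \<le> ?cR\<close>]
  have u: "\<bar>?u \<bullet> (R *v ?u)\<bar> \<le> ?cR * (2 * (norm ?v)\<^sup>2 + 2 * (?x\<^sup>2 * (norm K)\<^sup>2))"
    using abs_quadratic_form_le[of ?u R] by linarith
  have v: "\<bar>\<tau> / 2 * (?v \<bullet> (matrix_inv S *v ?v))\<bar> \<le> \<bar>\<tau>\<bar> / 2 * (onorm ((*v) (matrix_inv S)) * (norm ?v)\<^sup>2)"
    using abs_quadratic_form_le[of ?v "matrix_inv S"] by (simp add: abs_mult mult_left_mono)
  have "\<bar>stage_cost Q R \<tau> t \<omega>\<bar>
      \<le> \<bar>Q\<bar> * ?x\<^sup>2 + \<bar>?u \<bullet> (R *v ?u)\<bar> + \<bar>\<tau> / 2 * (?v \<bullet> (matrix_inv S *v ?v))\<bar> + \<bar>\<tau> / 2 * ?lnZ\<bar>"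
    using abs_mult[of Q "?x\<^sup>2"] unfolding stage_cost_eq by simp
  also have "\<dots> \<le> \<bar>Q\<bar> * ?x\<^sup>2 + ?cR * (2 * (norm ?v)\<^sup>2 + 2 * (?x\<^sup>2 * (norm K)\<^sup>2))
      + \<bar>\<tau>\<bar> / 2 * (onorm ((*v) (matrix_inv S)) * (norm ?v)\<^sup>2) + \<bar>\<tau> / 2 * ?lnZ\<bar>"
    using u v by linarith
  finally show ?thesis by (simp add: algebra_simps)
qed

lemma discounted_state_sq_sums:
  assumes \<gamma>: "0 \<le> \<gamma>" "\<gamma> < 1" "\<gamma> * V_K A C B D K < 1"
  shows "(\<lambda>t. \<gamma> ^ t * expectation (\<lambda>\<omega>. (state t \<omega>)\<^sup>2)) sums
    ((x0\<^sup>2 + \<gamma> * trace (S ** (outer B B + transpose D ** D)) / (1 - \<gamma>)) / (1 - \<gamma> * V_K A C B D K))"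
proof -
  have "0 \<le> trace (S ** (outer B B + transpose D ** D))"
    using input_noise_sq_moment(2)[of 0, symmetric] by simp
  moreover have "0 \<le> V_K A C B D K" unfolding V_K_eq by simp
  moreover have "0 \<le> expectation (\<lambda>\<omega>. (state t \<omega>)\<^sup>2)" for t by simp
  ultimately have "(\<lambda>t. \<gamma> ^ t * expectation (\<lambda>\<omega>. (state t \<omega>)\<^sup>2)) sums
      ((expectation (\<lambda>\<omega>. (state 0 \<omega>)\<^sup>2) + \<gamma> * trace (S ** (outer B B + transpose D ** D)) / (1 - \<gamma>))
       / (1 - \<gamma> * V_K A C B D K))"
    using \<gamma> by (intro sums_discounted_affine_recurrence state_sq_Suc(2) state_sq_integrable)
  then show ?thesis by (simp add: prob_space)
qed

lemma summable_abs_discounted_stage_cost: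
  assumes \<gamma>: "0 \<le> \<gamma>" "\<gamma> < 1" "\<gamma> * V_K A C B D K < 1"
  shows "summable (\<lambda>t. \<integral>\<omega>. \<bar>\<gamma> ^ t * stage_cost Q R \<tau> t \<omega>\<bar> \<partial>M)"
proof -
  define b1 where "b1 = \<bar>Q\<bar> + 2 * onorm ((*v) R) * (norm K)\<^sup>2"
  define b2 where "b2 = 2 * onorm ((*v) R) + \<bar>\<tau>\<bar> / 2 * onorm ((*v) (matrix_inv S))"
  define b3 where "b3 = \<bar>\<tau> / 2 * ln ((2 * pi) ^ CARD('n) * det S)\<bar>"
  have xi_sq: "integrable M (\<lambda>\<omega>. (norm (xi t \<omega>))\<^sup>2)" "expectation (\<lambda>\<omega>. (norm (xi t \<omega>))\<^sup>2) = trace S" for t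
    using xi_inner_moments(5,6)[of t "mat 1"] by (simp_all add: power2_norm_eq_inner)
  have summable_bound: "summable (\<lambda>t. \<gamma> ^ t * (b1 * expectation (\<lambda>\<omega>. (state t \<omega>)\<^sup>2) + b2 * trace S + b3))"
  proof -
    have "summable (\<lambda>t. b1 * (\<gamma> ^ t * expectation (\<lambda>\<omega>. (state t \<omega>)\<^sup>2)) + (b2 * trace S + b3) * \<gamma> ^ t)"
      using sums_summable[OF discounted_state_sq_sums[OF \<gamma>]] \<gamma>
      by (intro summable_add summable_mult summable_geometric) auto
    then show ?thesis by (simp add: algebra_simps)
  qed
  show ?thesis
  proof (rule summable_comparison_test'[OF summable_bound, of 0])
    fix t
    have "(\<integral>\<omega>. \<bar>stage_cost Q R \<tau> t \<omega>\<bar> \<partial>M)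
        \<le> (\<integral>\<omega>. b1 * (state t \<omega>)\<^sup>2 + b2 * (norm (xi t \<omega>))\<^sup>2 + b3 \<partial>M)"
      using stage_cost_moment(1) state_sq_integrable xi_sq abs_stage_cost_le
      unfolding b1_def b2_def b3_def by (intro integral_mono) auto
    also have "\<dots> = b1 * expectation (\<lambda>\<omega>. (state t \<omega>)\<^sup>2) + b2 * trace S + b3"
      using state_sq_integrable xi_sq by (simp add: prob_space)
    finally have "(\<integral>\<omega>. \<bar>\<gamma> ^ t * stage_cost Q R \<tau> t \<omega>\<bar> \<partial>M)
        \<le> \<gamma> ^ t * (b1 * expectation (\<lambda>\<omega>. (state t \<omega>)\<^sup>2) + b2 * trace S + b3)"
      using \<gamma> by (simp add: abs_mult mult_left_mono)
    moreover have "0 \<le> (\<integral>\<omega>. \<bar>\<gamma> ^ t * stage_cost Q R \<tau> t \<omega>\<bar> \<partial>M)"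
      by (rule integral_nonneg_AE) simp
    ultimately show "norm (\<integral>\<omega>. \<bar>\<gamma> ^ t * stage_cost Q R \<tau> t \<omega>\<bar> \<partial>M)
        \<le> \<gamma> ^ t * (b1 * expectation (\<lambda>\<omega>. (state t \<omega>)\<^sup>2) + b2 * trace S + b3)"
      by simp
  qed
qed

lemma ctrl_cost_eq_suminf:
  assumes \<gamma>: "0 \<le> \<gamma>" "\<gamma> < 1" "\<gamma> * V_K A C B D K < 1"
  shows "ctrl_cost M A C B D Q R \<gamma> \<tau> K S wx wu xi x0 = (\<Sum>t. \<gamma> ^ t * expectation (stage_cost Q R \<tau> t))"
proof -
  have "ctrl_cost M A C B D Q R \<gamma> \<tau> K S wx wu xi x0 = (\<integral>\<omega>. (\<Sum>t. \<gamma> ^ t * stage_cost Q R \<tau> t \<omega>) \<partial>M)"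
    unfolding ctrl_cost_def stage_cost_def ..
  also have "\<dots> = (\<Sum>t. \<integral>\<omega>. \<gamma> ^ t * stage_cost Q R \<tau> t \<omega> \<partial>M)"
    using stage_cost_moment(1) summable_abs_discounted_stage_cost[OF \<gamma>]
    by (intro integral_suminf_abs_summable) auto
  finally show ?thesis by simp
qed

lemma ctrl_cost_eq:
  assumes \<gamma>: "0 \<le> \<gamma>" "\<gamma> < 1" "\<gamma> * V_K A C B D K < 1"
    and P: "P = Q + K \<bullet> (R *v K) + \<gamma> * P * V_K A C B D K"
  shows "ctrl_cost M A C B D Q R \<gamma> \<tau> K S wx wu xi x0 = P * x0\<^sup>2
    + (trace (S ** (R + (\<gamma> * P) *\<^sub>R (outer B B + transpose D ** D)))
       - \<tau> / 2 * (real CARD('n) + ln ((2 * pi) ^ CARD('n) * det S))) / (1 - \<gamma>)"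
proof -
  let ?V = "V_K A C B D K" and ?T = "trace (S ** (outer B B + transpose D ** D))"
  let ?c = "Q + K \<bullet> (R *v K)"
  let ?d = "trace (S ** R) - \<tau> / 2 * (real CARD('n) + ln ((2 * pi) ^ CARD('n) * det S))"
  have ne: "1 - \<gamma> \<noteq> 0" "1 - \<gamma> * ?V \<noteq> 0" using \<gamma> by auto
  have P_eq: "P = ?c / (1 - \<gamma> * ?V)"
    using P ne by (simp add: eq_divide_eq algebra_simps)
  have "\<gamma> ^ t * expectation (stage_cost Q R \<tau> t)
      = ?c * (\<gamma> ^ t * expectation (\<lambda>\<omega>. (state t \<omega>)\<^sup>2)) + ?d * \<gamma> ^ t" for t
    by (simp add: stage_cost_moment(2) algebra_simps)
  moreover have "(\<lambda>t. ?c * (\<gamma> ^ t * expectation (\<lambda>\<omega>. (state t \<omega>)\<^sup>2)) + ?d * \<gamma> ^ t) sums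
      (?c * ((x0\<^sup>2 + \<gamma> * ?T / (1 - \<gamma>)) / (1 - \<gamma> * ?V)) + ?d * (1 / (1 - \<gamma>)))"
    using \<gamma> by (intro sums_add sums_mult discounted_state_sq_sums geometric_sums) auto
  ultimately have "ctrl_cost M A C B D Q R \<gamma> \<tau> K S wx wu xi x0
      = ?c * ((x0\<^sup>2 + \<gamma> * ?T / (1 - \<gamma>)) / (1 - \<gamma> * ?V)) + ?d * (1 / (1 - \<gamma>))"
    unfolding ctrl_cost_eq_suminf[OF \<gamma>] by (simp add: sums_iff)
  also have "\<dots> = P * x0\<^sup>2 + (?d + \<gamma> * P * ?T) / (1 - \<gamma>)"
  proof -
    have "c * ((x + g * T / b) / a) + c0 * (1 / b) = c / a * x + (c0 + g * (c / a) * T) / b"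
      if "a \<noteq> 0" "b \<noteq> 0" for a b c x T c0 g :: real
      using that by (simp add: field_simps)
    from this[OF ne(2,1)] show ?thesis unfolding P_eq .
  qed
  also have "?d + \<gamma> * P * ?T = trace (S ** (R + (\<gamma> * P) *\<^sub>R (outer B B + transpose D ** D)))
      - \<tau> / 2 * (real CARD('n) + ln ((2 * pi) ^ CARD('n) * det S))"
    by (simp add: matrix_add_ldistrib trace_add trace_mult_scaleR)
  finally show ?thesis .
qed

end

theorem lemma2:
  fixes M :: "'a measure" and Dist :: "real measure"
    and A C Q \<gamma> \<tau> :: real and B :: "real^'n" and D R :: "real^'n^'n"
    and K :: "real^'n" and S :: "real^'n^'n"
    and wx :: "nat \<Rightarrow> 'a \<Rightarrow> real" and wu xi :: "nat \<Rightarrow> 'a \<Rightarrow> real^'n"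
  assumes R_sym: "transpose R = R"
    and gamma: "0 < \<gamma>" "\<gamma> < 1" and tau: "0 < \<tau>"
    and Omega: "(K, S) \<in> Omega \<gamma> A C B D"
    and M: "prob_space M"
    and meas: "\<And>t. wx t \<in> borel_measurable M" "\<And>t. wu t \<in> borel_measurable M"
              "\<And>t. xi t \<in> borel_measurable M"
    and indep: "prob_space.indep_sets M (noise_events M wx wu xi) (UNIV \<times> {0, 1, 2})"
    and wx_int: "\<And>t. integrable M (wx t)" "\<And>t. integrable M (\<lambda>\<omega>. (wx t \<omega>)^2)"
    and wx_mom: "\<And>t. integral\<^sup>L M (wx t) = 0" "\<And>t. integral\<^sup>L M (\<lambda>\<omega>. (wx t \<omega>)^2) = 1"
    and wu_int: "\<And>t i. integrable M (\<lambda>\<omega>. wu t \<omega> $ i)"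
                "\<And>t i j. integrable M (\<lambda>\<omega>. wu t \<omega> $ i * wu t \<omega> $ j)"
    and wu_mom: "\<And>t i. integral\<^sup>L M (\<lambda>\<omega>. wu t \<omega> $ i) = 0"
                "\<And>t i j. integral\<^sup>L M (\<lambda>\<omega>. wu t \<omega> $ i * wu t \<omega> $ j) = (if i = j then 1 else 0)"
    and xi_gauss: "\<And>t. distributed M lborel (xi t) (\<lambda>u. ennreal (gauss_pdf S 0 u))"
    and Dist: "prob_space Dist" "sets Dist = sets borel" "integrable Dist (\<lambda>x. x^2)"
  shows "(\<exists>!P. P = Q + K \<bullet> (R *v K) + \<gamma> * P * V_K A C B D K) \<and>
         (\<forall>P. P = Q + K \<bullet> (R *v K) + \<gamma> * P * V_K A C B D K \<longrightarrow>
            integral\<^sup>L Dist (\<lambda>x0. ctrl_cost M A C B D Q R \<gamma> \<tau> K S wx wu xi x0)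
            = P * integral\<^sup>L Dist (\<lambda>x. x^2)
              + (trace (S ** (R + (\<gamma> * P) *\<^sub>R (outer B B + transpose D ** D)))
                 - \<tau> / 2 * (real CARD('n) + ln ((2 * pi) ^ CARD('n) * det S))) / (1 - \<gamma>))"
proof -
  let ?V = "V_K A C B D K" and ?c = "Q + K \<bullet> (R *v K)"
  have S: "sym_posdef S" and \<gamma>V: "\<gamma> * ?V < 1" using Omega unfolding Omega_def by auto
  have cost: "ctrl_cost M A C B D Q R \<gamma> \<tau> K S wx wu xi x0 = P * x0\<^sup>2
      + (trace (S ** (R + (\<gamma> * P) *\<^sub>R (outer B B + transpose D ** D)))
         - \<tau> / 2 * (real CARD('n) + ln ((2 * pi) ^ CARD('n) * det S))) / (1 - \<gamma>)"
    if "P = ?c + \<gamma> * P * ?V" for P x0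
  proof -
    interpret lqr_closed_loop M wx wu xi A C B D K S x0
      by (rule lqr_closed_loop.intro[OF lqr_noise.intro[OF M lqr_noise_axioms.intro[OF meas indep]]
            lqr_closed_loop_axioms.intro[OF S wx_int wx_mom wu_int wu_mom xi_gauss]])
    show ?thesis using ctrl_cost_eq[OF _ gamma(2) \<gamma>V that] gamma(1) by simp
  qed
  interpret Dist: prob_space Dist by (rule Dist(1))
  have "P = ?c + \<gamma> * P * ?V \<longleftrightarrow> P = ?c / (1 - \<gamma> * ?V)" for P
    using \<gamma>V by (auto simp: eq_divide_eq algebra_simps)
  then show ?thesis
    using Dist(3) by (simp add: cost Dist.prob_space)
qed

end
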